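(* Let $R$ be a commutative ring with identity, let $\mathcal{I}$ be a non-empty set of proper ideals of $R$, and let $H$ be a subgroup of the group $\mathrm{Perm}(\mathcal{I})$ of permutations of $\mathcal{I}$. Let $\equiv_H$ be the equivalence relation on $\mathcal{I}$ whose classes are the $H$-orbits. If $\equiv_H$ is an $\omega$-congruence, then $\sim_\omega$ is an $H$-congruence on $\mathcal{I}$.
   Context: For a positive integer $n$, a proper ideal $I$ of $R$ is $n$-absorbing if for all $x_1,\ldots,x_{n+1}\in R$ with $x_1\cdots x_{n+1}\in I$ there are indices $1\le i_1<\cdots<i_n\le n+1$ such that $x_{i_1}\cdots x_{i_n}\in I$. For a proper ideal $I$, $\omega(I)\in\mathbb{N}\cup\{\infty\}$ (with $\mathbb{N}$ the set of positive integers) is the smallest positive integer $n$ such that $I$ is $n$-absorbing, and $\omega(I)=\infty$ if no such $n$ exists. The relation $\sim_\omega$ on $\mathcal{I}$ is the equivalence relation $I\sim_\omega J \iff \omega(I)=\omega(J)$. An equivalence relation $\equiv$ on $\mathcal{I}$ is an $\omega$-congruence if $I\equiv J$ implies $I\sim_\omega J$ for all $I,J\in\mathcal{I}$. An equivalence relation $\equiv$ on $\mathcal{I}$ is an $H$-congruence if for all $I,J\in\mathcal{I}$ and all $h\in H$, $I\equiv J \iff h(I)\equiv h(J)$. The group $H\subseteq \mathrm{Perm}(\mathcal{I})$ acts on $\mathcal{I}$ by evaluation, and the $H$-orbit of $I$ is $\{h(I) : h\in H\}$. *)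

theory Defs
  imports "HOL-Algebra.Algebra" "HOL-Library.Extended_Nat"
begin

definition proper_ideal :: "('a, 'm) ring_scheme \<Rightarrow> 'a set \<Rightarrow> bool" where
  "proper_ideal R I \<longleftrightarrow> ideal I R \<and> I \<noteq> carrier R"

text \<open>
  A choice of indices $1 \le i_1 < \cdots < i_n \le n+1$ is given by the
  \<open>n\<close>-element set \<open>A\<close> of the chosen indices.
\<close>

definition n_absorbing :: "('a, 'm) ring_scheme \<Rightarrow> nat \<Rightarrow> 'a set \<Rightarrow> bool" where
  "n_absorbing R n I \<longleftrightarrow> n > 0 \<and> proper_ideal R I \<and>
     (\<forall>x \<in> {1..n+1} \<rightarrow> carrier R.
        (\<Otimes>\<^bsub>R\<^esub>i\<in>{1..n+1}. x i) \<in> I \<longrightarrow>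
        (\<exists>A \<subseteq> {1..n+1}. card A = n \<and> (\<Otimes>\<^bsub>R\<^esub>i\<in>A. x i) \<in> I))"

definition omega :: "('a, 'm) ring_scheme \<Rightarrow> 'a set \<Rightarrow> enat" where
  "omega R I = (if \<exists>n. n_absorbing R n I then enat (LEAST n. n_absorbing R n I) else \<infinity>)"

definition omega_rel :: "('a, 'm) ring_scheme \<Rightarrow> 'a set set \<Rightarrow> ('a set \<times> 'a set) set" where
  "omega_rel R \<I> = {(I, J). I \<in> \<I> \<and> J \<in> \<I> \<and> omega R I = omega R J}"

definition omega_congruence ::
    "('a, 'm) ring_scheme \<Rightarrow> 'a set set \<Rightarrow> ('a set \<times> 'a set) set \<Rightarrow> bool" where
  "omega_congruence R \<I> r \<longleftrightarrow> equiv \<I> r \<and>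
     (\<forall>I \<in> \<I>. \<forall>J \<in> \<I>. (I, J) \<in> r \<longrightarrow> (I, J) \<in> omega_rel R \<I>)"

definition H_congruence :: "'b set \<Rightarrow> ('b \<Rightarrow> 'b) set \<Rightarrow> ('b \<times> 'b) set \<Rightarrow> bool" where
  "H_congruence S H r \<longleftrightarrow> equiv S r \<and>
     (\<forall>I \<in> S. \<forall>J \<in> S. \<forall>h \<in> H. (I, J) \<in> r \<longleftrightarrow> (h I, h J) \<in> r)"

text \<open>
  The group of permutations of \<open>S\<close> is \<^term>\<open>BijGroup S\<close>, whose elements are the bijections of
  \<open>S\<close> onto itself, set to \<^term>\<open>undefined\<close> outside \<open>S\<close>.  A subgroup \<open>H\<close> acts on \<open>S\<close> by
  evaluation, that is, through the map \<open>\<lambda>h. h\<close>.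
\<close>

definition perm_orbits :: "'b set \<Rightarrow> ('b \<Rightarrow> 'b) set \<Rightarrow> 'b set set" where
  "perm_orbits S H = orbits ((BijGroup S)\<lparr>carrier := H\<rparr>) S (\<lambda>h. h)"

definition orbit_rel :: "'b set \<Rightarrow> ('b \<Rightarrow> 'b) set \<Rightarrow> ('b \<times> 'b) set" where
  "orbit_rel S H = (\<Union>A \<in> perm_orbits S H. A \<times> A)"

lemma perm_group_action:
  assumes "subgroup H (BijGroup S)"
  shows "group_action ((BijGroup S)\<lparr>carrier := H\<rparr>) S (\<lambda>h. h)"
proof -
  interpret B: group "BijGroup S" by (rule group_BijGroup)
  have "group ((BijGroup S)\<lparr>carrier := H\<rparr>)"
    using assms B.subgroup_imp_group by blast
  moreover have "(\<lambda>h. h) \<in> hom ((BijGroup S)\<lparr>carrier := H\<rparr>) (BijGroup S)"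
    using subgroup.subset[OF assms] by (auto simp: hom_def)
  ultimately show ?thesis
    by (simp add: group_action_def group_hom_def group_hom_axioms_def B.is_group)
qed

text \<open>The classes of \<^const>\<open>orbit_rel\<close> are indeed the orbits.\<close>

lemma
  assumes "subgroup H (BijGroup S)"
  shows equiv_orbit_rel: "equiv S (orbit_rel S H)"
    and quotient_orbit_rel: "S // orbit_rel S H = perm_orbits S H"
proof -
  interpret group_action "(BijGroup S)\<lparr>carrier := H\<rparr>" S "\<lambda>h. h"
    using assms by (rule perm_group_action)
  have Un: "\<Union> (perm_orbits S H) = S"
    unfolding perm_orbits_def by (rule orbits_coverture)
  have disj: "A = B" if "A \<in> perm_orbits S H" "B \<in> perm_orbits S H" "x \<in> A" "x \<in> B" for A B x
    using that disjoint_union unfolding perm_orbits_def by blast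
  have ne: "A \<noteq> {}" if "A \<in> perm_orbits S H" for A
    using that orbit_refl unfolding perm_orbits_def orbits_def by fastforce
  show "equiv S (orbit_rel S H)"
  proof (rule equivI)
    show "orbit_rel S H \<subseteq> S \<times> S" unfolding orbit_rel_def using Un by blast
    show "refl_on S (orbit_rel S H)" unfolding orbit_rel_def refl_on_def using Un by blast
    show "sym (orbit_rel S H)" unfolding orbit_rel_def sym_def by blast
    show "trans (orbit_rel S H)" unfolding orbit_rel_def trans_def using disj by blast
  qed
  have cls: "orbit_rel S H `` {x} = A" if "A \<in> perm_orbits S H" "x \<in> A" for A x
    unfolding orbit_rel_def using that disj by blast
  show "S // orbit_rel S H = perm_orbits S H"
  proof
    show "S // orbit_rel S H \<subseteq> perm_orbits S H"
      unfolding quotient_def using Un cls by fastforce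
    show "perm_orbits S H \<subseteq> S // orbit_rel S H"
    proof
      fix A assume A: "A \<in> perm_orbits S H"
      then obtain x where x: "x \<in> A" using ne by blast
      with A have "x \<in> S" using Un by blast
      then show "A \<in> S // orbit_rel S H"
        using cls[OF A x] unfolding quotient_def by blast
    qed
  qed
qed

end

theory Submission
  imports Defs
begin

text \<open>
  Each \<open>h \<in> H\<close> carries \<open>I\<close> to a point of its own orbit, so if \<open>\<omega>\<close> is constant on orbits then
  \<open>\<omega> (h I) = \<omega> I\<close>: comparing \<open>\<omega> (h I)\<close> with \<open>\<omega> (h J)\<close> is comparing \<open>\<omega> I\<close> with \<open>\<omega> J\<close>.
\<close>

lemma orbit_rel_apply:
  assumes "subgroup H (BijGroup S)" and "h \<in> H" and "x \<in> S"
  shows "(x, h x) \<in> orbit_rel S H"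
proof -
  let ?G = "(BijGroup S)\<lparr>carrier := H\<rparr>"
  interpret group_action ?G S "\<lambda>h. h"
    using assms(1) by (rule perm_group_action)
  have "x \<in> orbit ?G (\<lambda>h. h) x"
    using assms(3) by (rule orbit_refl)
  moreover have "h x \<in> orbit ?G (\<lambda>h. h) x"
    using assms(2) unfolding orbit_def by auto
  moreover have "orbit ?G (\<lambda>h. h) x \<in> perm_orbits S H"
    using assms(3) unfolding perm_orbits_def orbits_def by blast
  ultimately show ?thesis
    unfolding orbit_rel_def by blast
qed

lemma equiv_omega_rel: "equiv \<I> (omega_rel R \<I>)"
  by (rule equivI) (auto simp: omega_rel_def refl_on_def sym_def trans_def)

theorem corollary3p2:
  fixes R :: "('a, 'm) ring_scheme" and \<I> :: "'a set set" and H :: "('a set \<Rightarrow> 'a set) set"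
  assumes "cring R"
    and "\<I> \<noteq> {}"
    and "\<And>I. I \<in> \<I> \<Longrightarrow> proper_ideal R I"
    and "subgroup H (BijGroup \<I>)"
    and "omega_congruence R \<I> (orbit_rel \<I> H)"
  shows "H_congruence \<I> H (omega_rel R \<I>)"
proof -
  have invariant: "h I \<in> \<I> \<and> omega R (h I) = omega R I" if "h \<in> H" "I \<in> \<I>" for h I
  proof -
    have orb: "(I, h I) \<in> orbit_rel \<I> H"
      using assms(4) that by (rule orbit_rel_apply)
    have "h I \<in> \<I>"
      using equiv_type[OF equiv_orbit_rel[OF assms(4)]] orb by blast
    with orb \<open>I \<in> \<I>\<close> have "(I, h I) \<in> omega_rel R \<I>"
      using assms(5) unfolding omega_congruence_def by blast
    then show ?thesis
      by (simp add: omega_rel_def)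
  qed
  have "(I, J) \<in> omega_rel R \<I> \<longleftrightarrow> (h I, h J) \<in> omega_rel R \<I>"
    if "I \<in> \<I>" "J \<in> \<I>" "h \<in> H" for I J h
    using that invariant by (simp add: omega_rel_def)
  with equiv_omega_rel show ?thesis
    unfolding H_congruence_def by blast
qed

end
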